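(* Let $\Omega\subset\mathbb{R}^2$ be the domain described in the context, with singularity points $(0,0)$ and $(0,b)$. Assume that $x_2$ is an analytic function of $x_1$ around the singularity points (i.e. around each singularity point $\Gamma$ is the graph $x_2=x_2(x_1)$ of an analytic function). Then there exist $N\in\mathbb{N}$ and $C>0$ such that, around each singularity point, $$|x_2(x_1)-x_2(y_1)|\ge C|x_1-y_1|^N\qquad\text{for all }x_1,y_1\text{ with }(x_1,x_2(x_1)),\,(y_1,x_2(y_1))\in\Gamma_{in}^s.$$
   Context: $\Omega\subset\mathbb{R}^2$ is a bounded domain of class $C^3$ with boundary $\Gamma$ consisting of $$\Gamma_{in}=\{(\underline{x_1}(x_2),x_2):x_2\in(0,b)\},\qquad\Gamma_{out}=\{(\overline{x_1}(x_2),x_2):x_2\in(0,b)\}$$ and the two singularity points $\Gamma_*=\{(0,0),(0,b)\}$, where $\underline{x_1},\overline{x_1}\to0$ as $x_2\to0^+$ and as $x_2\to b^-$, $\underline{x_1}'\to-\infty$ and $\overline{x_1}'\to+\infty$ as $x_2\to0^+$, $\underline{x_1}'\to+\infty$ and $\overline{x_1}'\to-\infty$ as $x_2\to b^-$, and there are no other singularity points (points of $\Gamma_{in}\cup\Gamma_{out}$ where $|\underline{x_1}'|$ or $|\overline{x_1}'|$ is infinite). Thus near each singularity point $\Gamma$ is a graph $x_2=x_2(x_1)$ with $x_2'=0$ at that point. $\Gamma_{in}^s=\{x\in\Gamma_{in}:\operatorname{dist}(x,\Gamma_* )<2\eta\}$, where $\eta>0$ is a sufficiently small fixed number. *)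

theory Defs
  imports "HOL-Analysis.Analysis"
begin

definition Ck_real :: "nat \<Rightarrow> (real \<Rightarrow> real) \<Rightarrow> bool" where
  "Ck_real k f \<longleftrightarrow>
     (\<forall>j<k. \<forall>t. (deriv ^^ j) f differentiable (at t)) \<and> continuous_on UNIV ((deriv ^^ k) f)"

(* The boundary is locally the graph of a C^k function, with D strictly on one side of it, after an
   orthogonal change of coordinates T. *)
definition Ck_domain :: "nat \<Rightarrow> (real \<times> real) set \<Rightarrow> bool" where
  "Ck_domain k D \<longleftrightarrow>
     open D \<and> connected D \<and> D \<noteq> {} \<and>
     (\<forall>p \<in> frontier D. \<exists>T r g. orthogonal_transformation T \<and> r > 0 \<and> Ck_real k g \<and>
        D \<inter> ball p r = {x \<in> ball p r. snd (T x) > g (fst (T x))})"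

definition real_analytic_on :: "(real \<Rightarrow> real) \<Rightarrow> real set \<Rightarrow> bool" where
  "real_analytic_on f S \<longleftrightarrow>
     (\<forall>x\<in>S. \<exists>r>0. \<exists>a. \<forall>y. \<bar>y - x\<bar> < r \<longrightarrow> (\<lambda>n. a n * (y - x) ^ n) sums f y)"

definition side_curve :: "(real \<Rightarrow> real) \<Rightarrow> real \<Rightarrow> (real \<times> real) set" where
  "side_curve f b = {(f s, s) | s. s \<in> {0<..<b}}"

definition singular_points :: "real \<Rightarrow> (real \<times> real) set" where
  "singular_points b = {(0, 0), (0, b)}"

(* xl and xu parametrise the inflow and outflow parts of the boundary by the second coordinate.
   Differentiability of both on the open interval expresses that their slopes become infinite
   nowhere except at its two ends. *)
definition two_singularity_domain ::
  "(real \<times> real) set \<Rightarrow> real \<Rightarrow> (real \<Rightarrow> real) \<Rightarrow> (real \<Rightarrow> real) \<Rightarrow> bool" where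
  "two_singularity_domain D b xl xu \<longleftrightarrow>
     0 < b \<and> bounded D \<and> Ck_domain 3 D \<and>
     frontier D = side_curve xl b \<union> side_curve xu b \<union> singular_points b \<and>
     (xl \<longlongrightarrow> 0) (at_right 0) \<and> (xu \<longlongrightarrow> 0) (at_right 0) \<and>
     (xl \<longlongrightarrow> 0) (at_left b) \<and> (xu \<longlongrightarrow> 0) (at_left b) \<and>
     (\<forall>s\<in>{0<..<b}. xl differentiable (at s) \<and> xu differentiable (at s)) \<and>
     filterlim (deriv xl) at_bot (at_right 0) \<and> filterlim (deriv xu) at_top (at_right 0) \<and>
     filterlim (deriv xl) at_top (at_left b) \<and> filterlim (deriv xu) at_bot (at_left b)"

(* Inside some box of half-width d around p, the set G is exactly the graph
   (x1, f x1) of an analytic function of the first coordinate. *)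
definition analytic_graph_near ::
  "(real \<times> real) set \<Rightarrow> real \<times> real \<Rightarrow> (real \<Rightarrow> real) \<Rightarrow> real \<Rightarrow> bool" where
  "analytic_graph_near G p f d \<longleftrightarrow>
     d > 0 \<and> real_analytic_on f {fst p - d<..<fst p + d} \<and>
     (\<exists>e>0. G \<inter> ({fst p - d<..<fst p + d} \<times> {snd p - e<..<snd p + e})
             = {(t, f t) | t. t \<in> {fst p - d<..<fst p + d}})"

definition inflow_near_sing :: "(real \<Rightarrow> real) \<Rightarrow> real \<Rightarrow> real \<Rightarrow> (real \<times> real) set" where
  "inflow_near_sing xl b \<eta> = {x \<in> side_curve xl b. infdist x (singular_points b) < 2 * \<eta>}"

end

theory Submission
  imports Defs
begin

text \<open>
  Near a singularity point \<open>(0, c)\<close> the boundary is the graph of an analytic function \<open>f\<close>, and the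
  inflow curve consists of the points \<open>(xl s, s)\<close>, so that \<open>f (xl s) = s\<close> for \<open>s\<close> close to \<open>c\<close>. Hence
  \<open>f\<close> is not constant near \<open>0\<close>, and its derivative vanishes there to some finite order \<open>m\<close>: it is
  \<open>t ^ m * h t\<close> with \<open>h\<close> continuous and \<open>h 0 \<noteq> 0\<close>. Comparing \<open>f\<close> with \<open>t ^ Suc m\<close> by Cauchy's mean
  value theorem shows that \<open>\<bar>f y - f z\<bar>\<close> is at least a constant times \<open>\<bar>y ^ Suc m - z ^ Suc m\<bar>\<close>. If
  \<open>y\<close> and \<open>z\<close> lie on the same side of \<open>0\<close>, this is at least that constant times \<open>\<bar>y - z\<bar> ^ Suc m\<close>
  (\<open>power_series_separation\<close>). On opposite sides it can vanish, as \<open>t ^ 2\<close> shows.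

  The inflow curve does stay on one side: the signs of the infinite slopes of \<open>xl\<close> make it decrease
  from its limit \<open>0\<close> at the lower singularity point and increase to its limit \<open>0\<close> at the upper one, so
  \<open>xl \<le> 0\<close> close to either (\<open>nonpos_right_of_singularity\<close>, \<open>nonpos_left_of_singularity\<close>).

  A point \<open>(x, f x)\<close> that is close to some singularity point is close to \<open>(0, c)\<close>: if \<open>x\<close> is small,
  then \<open>f x\<close> is close to \<open>f 0 = c\<close> by continuity, hence away from the height of the other singularity
  point (\<open>inflow_separation_at_singularity\<close>). A common exponent and constant for both points come
  from \<open>\<bar>x - y\<bar> \<le> 1\<close>, which allows the exponent to be raised.
\<close>

section \<open>Separation of the values of a power series on one side of its centre\<close>

lemma power_diff_le_diff_power:
  fixes u v :: real
  assumes "0 \<le> u" "u \<le> v"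
  shows "(v - u) ^ Suc n \<le> v ^ Suc n - u ^ Suc n"
proof (induction n)
  case (Suc n)
  have "(v - u) ^ Suc (Suc n) \<le> (v - u) * (v ^ Suc n - u ^ Suc n)"
    using Suc assms by (simp add: mult_left_mono)
  also have "\<dots> \<le> v ^ Suc (Suc n) - u ^ Suc (Suc n)"
  proof -
    have "u ^ Suc n \<le> v ^ Suc n"
      using assms by (intro power_mono) auto
    then have "0 \<le> u * (v ^ Suc n - u ^ Suc n)" "0 \<le> u ^ Suc n * (v - u)"
      using assms by auto
    then show ?thesis by (simp add: algebra_simps)
  qed
  finally show ?case .
qed simp

lemma power_series_derivative:
  fixes f :: "real \<Rightarrow> real"
  assumes sums: "\<And>t. \<bar>t\<bar> < r \<Longrightarrow> (\<lambda>n. a n * t ^ n) sums f t" and t: "\<bar>t\<bar> < r"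
  shows "(f has_real_derivative (\<Sum>n. diffs a n * t ^ n)) (at t)"
    and "summable (\<lambda>n. diffs a n * t ^ n)"
proof -
  have summ: "summable (\<lambda>n. a n * x ^ n)" if "norm x < r" for x
    using sums[of x] that by (auto simp: sums_iff)
  show "summable (\<lambda>n. diffs a n * t ^ n)"
    by (rule termdiff_converges[where K = r]) (use summ t in auto)
  have "((\<lambda>x. \<Sum>n. a n * x ^ n) has_real_derivative (\<Sum>n. diffs a n * t ^ n)) (at t)"
    by (rule termdiffs_strong'[where K = r]) (use summ t in auto)
  then show "(f has_real_derivative (\<Sum>n. diffs a n * t ^ n)) (at t)"
    by (rule has_field_derivative_transform_within_open[where S = "{-r<..<r}"])
      (use t sums in \<open>auto simp: sums_iff abs_less_iff\<close>)
qed

text \<open>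
  Dropping the leading zero coefficients divides the series by \<open>t ^ m\<close> without changing its disc of
  convergence, so the quotient is continuous and its value at \<open>0\<close> is the first remaining coefficient.
\<close>

lemma power_series_factor:
  fixes c :: "nat \<Rightarrow> real"
  assumes r: "r > 0" and summ: "\<And>t. \<bar>t\<bar> < r \<Longrightarrow> summable (\<lambda>n. c n * t ^ n)"
    and low: "\<And>n. n < m \<Longrightarrow> c n = 0"
  obtains h where "isCont h 0" "h 0 = c m"
    "\<And>t. \<bar>t\<bar> < r \<Longrightarrow> (\<Sum>n. c n * t ^ n) = t ^ m * h t"
proof
  define h where "h = (\<lambda>t. \<Sum>n. c (n + m) * t ^ n)"
  show "isCont h 0"
    unfolding h_def
    by (rule isCont_powser[where K = "r / 2"])
      (use r summ[of "r / 2"] in \<open>auto simp: summable_powser_ignore_initial_segment\<close>)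
  show "h 0 = c m"
    unfolding h_def by (subst powser_zero) simp
  show "(\<Sum>n. c n * t ^ n) = t ^ m * h t" if "\<bar>t\<bar> < r" for t
  proof -
    have "summable (\<lambda>n. c (n + m) * t ^ n)"
      using summ[OF that] by (simp add: summable_powser_ignore_initial_segment)
    then have "(\<lambda>n. t ^ m * (c (n + m) * t ^ n)) sums (t ^ m * h t)"
      unfolding h_def by (intro sums_mult summable_sums)
    then have "(\<lambda>n. c (n + m) * t ^ (n + m)) sums (t ^ m * h t)"
      by (simp add: power_add mult_ac)
    then have "(\<lambda>n. c n * t ^ n) sums (t ^ m * h t)"
      using sums_zero_iff_shift[of m "\<lambda>n. c n * t ^ n"] low by simp
    then show ?thesis by (simp add: sums_iff)
  qed
qed

text \<open>
  With \<open>m\<close> the order of vanishing of \<open>f'\<close> at \<open>0\<close>, the quotient of \<open>f'\<close> by the derivative of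
  \<open>t ^ Suc m\<close> stays away from zero near \<open>0\<close>. By Cauchy's mean value theorem, so does the quotient of
  the increments of the two functions, and on a half-line the increments of \<open>t ^ Suc m\<close> dominate
  those of the argument raised to the same power.
\<close>

lemma power_series_separation:
  fixes f :: "real \<Rightarrow> real"
  assumes r: "r > 0" and sums: "\<And>t. \<bar>t\<bar> < r \<Longrightarrow> (\<lambda>n. a n * t ^ n) sums f t"
    and nonconst: "\<bar>t0\<bar> < r" "f t0 \<noteq> f 0"
  obtains N C \<rho> where "C > 0" "\<rho> > 0"
    "\<And>y z. y \<in> {-\<rho><..0} \<Longrightarrow> z \<in> {-\<rho><..0} \<Longrightarrow> C * \<bar>y - z\<bar> ^ N \<le> \<bar>f y - f z\<bar>"
proof -
  have deriv: "(f has_real_derivative (\<Sum>n. diffs a n * t ^ n)) (at t)"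
    "summable (\<lambda>n. diffs a n * t ^ n)" if "\<bar>t\<bar> < r" for t
    by (rule power_series_derivative[of r a f t]; fact sums that)+
  have "\<exists>n. diffs a n \<noteq> 0"
  proof (rule ccontr)
    assume "\<nexists>n. diffs a n \<noteq> 0"
    then have zero: "a (Suc n) = 0" for n
      by (auto simp: diffs_def)
    have "a 0 = f 0" using sums[of 0] r by simp
    moreover have "(\<lambda>n. a n * t0 ^ n) sums a 0"
    proof -
      have "a n * t0 ^ n = 0" if "n \<notin> {0}" for n
        using that zero by (cases n) auto
      then have "(\<lambda>n. a n * t0 ^ n) sums (\<Sum>n\<in>{0}. a n * t0 ^ n)"
        by (rule sums_finite[rotated]) simp_all
      then show ?thesis by simp
    qed
    ultimately show False
      using sums[OF nonconst(1)] nonconst(2) sums_unique2 by metis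
  qed
  then obtain m where m: "diffs a m \<noteq> 0" and low: "\<And>n. n < m \<Longrightarrow> diffs a n = 0"
    using exists_least_iff[of "\<lambda>n. diffs a n \<noteq> 0"] by auto
  obtain h where h: "isCont h 0" "h 0 = diffs a m"
    and factor: "\<And>t. \<bar>t\<bar> < r \<Longrightarrow> (\<Sum>n. diffs a n * t ^ n) = t ^ m * h t"
    by (rule power_series_factor[OF r, of "diffs a" m]) (use deriv(2) low in auto)
  define k where "k = \<bar>diffs a m\<bar> / 2"
  have k: "k > 0" using m by (simp add: k_def)
  then obtain \<sigma> where \<sigma>: "\<sigma> > 0" "\<And>t. \<bar>t\<bar> < \<sigma> \<Longrightarrow> \<bar>h t - h 0\<bar> < k"
    using h(1) unfolding continuous_at_eps_delta dist_real_def by force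
  define \<rho> where "\<rho> = min r \<sigma>"
  have lower: "k \<le> \<bar>h t\<bar>" if "\<bar>t\<bar> < \<rho>" for t
    using \<sigma>(2)[of t] that h(2) unfolding \<rho>_def k_def by linarith
  have sep: "k / Suc m * (z - y) ^ Suc m \<le> \<bar>f z - f y\<bar>"
    if yz: "-\<rho> < y" "y < z" "z \<le> 0" for y z
  proof -
    have df: "(f has_real_derivative t ^ m * h t) (at t)" if "y \<le> t" "t \<le> z" for t
      using deriv(1)[of t] factor[of t] that yz by (simp add: \<rho>_def)
    have dg: "((\<lambda>t. t ^ Suc m) has_real_derivative real (Suc m) * t ^ m) (at t)" for t :: real
      using DERIV_pow[of "Suc m" t] by simp
    have "\<exists>w. y < w \<and> w < z \<and>
      (f z - f y) * (real (Suc m) * w ^ m) = (z ^ Suc m - y ^ Suc m) * (w ^ m * h w)"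
      using yz(2) df dg by (intro GMVT'; blast intro: DERIV_isCont less_imp_le)
    then obtain w where w: "y < w" "w < z"
      "(f z - f y) * (real (Suc m) * w ^ m) = (z ^ Suc m - y ^ Suc m) * (w ^ m * h w)"
      by blast
    \<comment> \<open>The mean value point lies strictly to the left of \<open>0\<close>, so the common factor cancels.\<close>
    have "w ^ m \<noteq> 0" using w yz by simp
    moreover have "w ^ m * ((f z - f y) * real (Suc m)) = w ^ m * ((z ^ Suc m - y ^ Suc m) * h w)"
      using w(3) by (simp only: mult_ac)
    ultimately have eq: "(f z - f y) * real (Suc m) = (z ^ Suc m - y ^ Suc m) * h w"
      using mult_left_cancel by blast
    have "(z - y) ^ Suc m \<le> (-y) ^ Suc m - (-z) ^ Suc m"
      using power_diff_le_diff_power[of "-z" "-y" m] yz by simp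
    also have "\<dots> \<le> \<bar>z ^ Suc m - y ^ Suc m\<bar>"
      by (auto simp: minus_one_power_iff power_minus[of y] power_minus[of z] simp del: power_Suc)
    finally have "(z - y) ^ Suc m * k \<le> \<bar>z ^ Suc m - y ^ Suc m\<bar> * \<bar>h w\<bar>"
      using lower[of w] w yz k by (intro mult_mono) auto
    also have "\<dots> = \<bar>f z - f y\<bar> * real (Suc m)"
      using eq by (metis abs_mult abs_of_nat)
    finally show ?thesis by (simp add: field_simps del: power_Suc of_nat_Suc)
  qed
  show ?thesis
  proof (rule that[of "k / Suc m" \<rho> "Suc m"])
    show "k / Suc m > 0" "\<rho> > 0" using k r \<sigma>(1) by (auto simp: \<rho>_def)
    show "k / Suc m * \<bar>y - z\<bar> ^ Suc m \<le> \<bar>f y - f z\<bar>"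
      if "y \<in> {-\<rho><..0}" "z \<in> {-\<rho><..0}" for y z
      using sep[of y z] sep[of z y] that
      by (cases y z rule: linorder_cases) (auto simp: abs_minus_commute simp del: power_Suc of_nat_Suc)
  qed
qed

section \<open>The inflow curve near a singularity point\<close>

text \<open>
  The derivative is eventually negative, so going back towards \<open>c\<close> the values of \<open>g\<close> can only grow,
  and they grow to the limit \<open>0\<close>.
\<close>

lemma nonpos_right_of_singularity:
  fixes g :: "real \<Rightarrow> real"
  assumes lim: "(g \<longlongrightarrow> 0) (at_right c)" and slope: "filterlim (deriv g) at_bot (at_right c)"
    and diff: "eventually (\<lambda>s. g differentiable (at s)) (at_right c)"
  shows "eventually (\<lambda>s. g s \<le> 0) (at_right c)"
proof -
  have "eventually (\<lambda>s. g differentiable (at s) \<and> deriv g s \<le> 0) (at_right c)"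
    using slope diff by (auto simp: filterlim_at_bot elim: eventually_elim2)
  then obtain e where e: "e > c" "\<And>s. c < s \<Longrightarrow> s < e \<Longrightarrow> g differentiable (at s) \<and> deriv g s \<le> 0"
    by (auto simp: eventually_at_right_field)
  have "g s \<le> 0" if s: "c < s" "s < e" for s
  proof (rule tendsto_lowerbound[OF lim])
    have "g s \<le> g u" if u: "c < u" "u < s" for u
    proof (rule DERIV_nonpos_imp_nonincreasing[where f = g])
      show "\<exists>y. (g has_real_derivative y) (at x) \<and> y \<le> 0" if "u \<le> x" "x \<le> s" for x
        using e(2)[of x] that u s DERIV_deriv_iff_real_differentiable by force
    qed (use u in simp)
    then show "eventually (\<lambda>u. g s \<le> g u) (at_right c)"
      using s by (auto simp: eventually_at_right_field)
  qed simp
  then show ?thesis using e(1) by (auto simp: eventually_at_right_field)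
qed

lemma nonpos_left_of_singularity:
  fixes g :: "real \<Rightarrow> real"
  assumes lim: "(g \<longlongrightarrow> 0) (at_left c)" and slope: "filterlim (deriv g) at_top (at_left c)"
    and diff: "eventually (\<lambda>s. g differentiable (at s)) (at_left c)"
  shows "eventually (\<lambda>s. g s \<le> 0) (at_left c)"
proof -
  have "eventually (\<lambda>s. g differentiable (at s) \<and> deriv g s \<ge> 0) (at_left c)"
    using slope diff by (auto simp: filterlim_at_top elim: eventually_elim2)
  then obtain e where e: "e < c" "\<And>s. e < s \<Longrightarrow> s < c \<Longrightarrow> g differentiable (at s) \<and> deriv g s \<ge> 0"
    by (auto simp: eventually_at_left_field)
  have "g s \<le> 0" if s: "e < s" "s < c" for s
  proof (rule tendsto_lowerbound[OF lim])
    have "g s \<le> g u" if u: "s < u" "u < c" for u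
    proof (rule DERIV_nonneg_imp_nondecreasing[where f = g])
      show "\<exists>y. (g has_real_derivative y) (at x) \<and> y \<ge> 0" if "s \<le> x" "x \<le> u" for x
        using e(2)[of x] that u s DERIV_deriv_iff_real_differentiable by force
    qed (use u in simp)
    then show "eventually (\<lambda>u. g s \<le> g u) (at_left c)"
      using s by (auto simp: eventually_at_left_field)
  qed simp
  then show ?thesis using e(1) by (auto simp: eventually_at_left_field)
qed

lemma inflow_near_sing_cases:
  assumes "(x, s) \<in> inflow_near_sing xl b \<eta>"
  obtains c where "c \<in> {0, b}" "\<bar>x\<bar> < 2 * \<eta>" "\<bar>s - c\<bar> < 2 * \<eta>"
    "s \<in> {0<..<b}" "x = xl s"
proof -
  have "infdist (x, s) (singular_points b) = min (dist (x, s) (0, 0)) (dist (x, s) (0, b))"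
    using infdist_Un_min[of "{(0, 0)}" "{(0, b)}" "(x, s)"]
    by (simp add: singular_points_def insert_commute)
  then obtain c where c: "c \<in> {0, b}" "dist (x, s) (0, c) < 2 * \<eta>"
    using assms by (auto simp: inflow_near_sing_def min_less_iff_disj)
  have "\<bar>x\<bar> < 2 * \<eta>" "\<bar>s - c\<bar> < 2 * \<eta>"
    using c(2) dist_fst_le[of "(x, s)" "(0, c)"] dist_snd_le[of "(x, s)" "(0, c)"]
    by (auto simp: dist_real_def)
  moreover have "s \<in> {0<..<b}" "x = xl s"
    using assms by (auto simp: inflow_near_sing_def side_curve_def)
  ultimately show thesis by (rule that[OF c(1)])
qed

text \<open>
  Both singularity points are covered at once: \<open>c\<close> is the height of the one under consideration and
  \<open>c'\<close> that of the other, and the filter \<open>at c within {0<..<b}\<close> is the one-sided filter at \<open>c\<close> along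
  which the inflow curve is parametrised.
\<close>

lemma inflow_separation_at_singularity:
  fixes f xl :: "real \<Rightarrow> real"
  assumes b: "0 < b" and cs: "{c, c'} = {0, b}"
    and graph: "analytic_graph_near G (0, c) f d" and pG: "(0, c) \<in> G"
    and curve: "side_curve xl b \<subseteq> G"
    and F: "at c within {0<..<b} \<noteq> bot"
    and lim: "(xl \<longlongrightarrow> 0) (at c within {0<..<b})"
    and nonpos: "eventually (\<lambda>s. xl s \<le> 0) (at c within {0<..<b})"
  obtains N C \<eta>0 where "C > 0" "\<eta>0 > 0"
    "\<And>x y \<eta>. x \<in> {-d<..<d} \<Longrightarrow> y \<in> {-d<..<d} \<Longrightarrow> \<eta> \<le> \<eta>0 \<Longrightarrow>
       (x, f x) \<in> inflow_near_sing xl b \<eta> \<Longrightarrow> (y, f y) \<in> inflow_near_sing xl b \<eta> \<Longrightarrow>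
       C * \<bar>x - y\<bar> ^ N \<le> \<bar>f x - f y\<bar>"
proof -
  have dist_cs: "\<bar>c - c'\<bar> = b" using cs b by (auto simp: doubleton_eq_iff)
  obtain e where d: "d > 0" and e: "e > 0"
    and box: "G \<inter> ({-d<..<d} \<times> {c - e<..<c + e}) = {(t, f t) | t. t \<in> {-d<..<d}}"
    and analytic: "real_analytic_on f {-d<..<d}"
    using graph unfolding analytic_graph_near_def by auto
  have onf: "f t = s" if "(t, s) \<in> G" "\<bar>t\<bar> < d" "\<bar>s - c\<bar> < e" for t s
  proof -
    have "(t, s) \<in> G \<inter> ({-d<..<d} \<times> {c - e<..<c + e})" using that by auto
    then show ?thesis unfolding box by auto
  qed
  have f0: "f 0 = c" using onf[OF pG] d e by simp
  obtain r a where r: "r > 0" and sums: "\<And>t. \<bar>t\<bar> < r \<Longrightarrow> (\<lambda>n. a n * t ^ n) sums f t"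
    using analytic[unfolded real_analytic_on_def, rule_format, of 0] d by auto
  \<comment> \<open>The inflow curve reaches heights other than \<open>c\<close> at arbitrarily small first coordinates, so \<open>f\<close> is
    not constant on the disc of convergence.\<close>
  have "eventually (\<lambda>s. \<bar>xl s\<bar> < min d r) (at c within {0<..<b})"
    using tendstoD[OF lim, of "min d r"] d r by (simp add: dist_real_def)
  moreover have "eventually (\<lambda>s. \<bar>s - c\<bar> < e \<and> s \<noteq> c \<and> s \<in> {0<..<b}) (at c within {0<..<b})"
    using e by (auto simp: eventually_at dist_real_def)
  ultimately have "eventually (\<lambda>s. \<bar>xl s\<bar> < r \<and> f (xl s) \<noteq> f 0) (at c within {0<..<b})"
  proof eventually_elim
    case (elim s)
    then have "(xl s, s) \<in> G" using curve by (auto simp: side_curve_def)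
    then show ?case using onf[of "xl s" s] elim f0 by auto
  qed
  then obtain t0 where t0: "\<bar>t0\<bar> < r" "f t0 \<noteq> f 0"
    using eventually_happens'[OF F] by blast
  obtain N C \<rho> where C: "C > 0" and \<rho>: "\<rho> > 0"
    and sep: "\<And>y z. y \<in> {-\<rho><..0} \<Longrightarrow> z \<in> {-\<rho><..0} \<Longrightarrow> C * \<bar>y - z\<bar> ^ N \<le> \<bar>f y - f z\<bar>"
  proof (rule power_series_separation[OF r _ t0, of a])
    show "(\<lambda>n. a n * t ^ n) sums f t" if "\<bar>t\<bar> < r" for t
      using that by (rule sums)
  qed (rule that)
  obtain \<delta> where \<delta>: "\<delta> > 0" "\<And>s. s \<in> {0<..<b} \<Longrightarrow> \<bar>s - c\<bar> < \<delta> \<Longrightarrow> xl s \<le> 0"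
  proof -
    have "c \<notin> {0<..<b}" using cs by (auto simp: doubleton_eq_iff)
    moreover obtain \<delta> where "\<delta> > 0" "\<forall>s\<in>{0<..<b}. s \<noteq> c \<and> dist s c < \<delta> \<longrightarrow> xl s \<le> 0"
      using nonpos unfolding eventually_at by blast
    ultimately show thesis by (intro that[of \<delta>]) (auto simp: dist_real_def)
  qed
  have "isCont f 0"
    by (rule DERIV_isCont, rule power_series_derivative(1)[of r a f 0]) (use sums r in auto)
  then obtain \<sigma> where \<sigma>: "\<sigma> > 0" "\<And>t. \<bar>t\<bar> < \<sigma> \<Longrightarrow> \<bar>f t - c\<bar> < b / 2"
    using b f0 unfolding continuous_at_eps_delta dist_real_def by (metis diff_zero half_gt_zero)
  \<comment> \<open>The bounds by \<open>\<sigma>\<close> and \<open>b / 2\<close> exclude the other singularity point, which has distance \<open>b\<close>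
    from this one. The bounds by \<open>\<delta>\<close> and \<open>\<rho>\<close> place the first coordinates in the half-interval on
    which the values of \<open>f\<close> are separated.\<close>
  define \<eta>0 where "\<eta>0 = Min {\<rho>, \<delta>, \<sigma>, b / 2} / 2"
  have \<eta>0: "2 * \<eta>0 \<le> \<rho>" "2 * \<eta>0 \<le> \<delta>" "2 * \<eta>0 \<le> \<sigma>" "2 * \<eta>0 \<le> b / 2" "\<eta>0 > 0"
    using \<rho> \<delta>(1) \<sigma>(1) b by (auto simp: \<eta>0_def)
  have side: "x \<in> {-\<rho><..0}" if "(x, f x) \<in> inflow_near_sing xl b \<eta>" "\<eta> \<le> \<eta>0" for x \<eta>
    using that(1)
  proof (rule inflow_near_sing_cases)
    fix k assume k: "k \<in> {0, b}" "\<bar>x\<bar> < 2 * \<eta>" "\<bar>f x - k\<bar> < 2 * \<eta>" "f x \<in> {0<..<b}" "x = xl (f x)"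
    have "k \<noteq> c'"
    proof
      assume "k = c'"
      then have "\<bar>f x - c'\<bar> < b / 2" "\<bar>f x - c\<bar> < b / 2"
        using \<sigma>(2)[of x] k(2,3) \<eta>0 that(2) by auto
      then show False using dist_cs by linarith
    qed
    moreover have "k \<in> {c, c'}" using k(1) unfolding cs .
    ultimately have "k = c" by simp
    then have "x \<le> 0" using \<delta>(2)[of "f x"] k \<eta>0 that(2) by auto
    then show ?thesis using k(2) \<eta>0 that(2) by auto
  qed
  show thesis
  proof (rule that[OF C \<eta>0(5)])
    show "C * \<bar>x - y\<bar> ^ N \<le> \<bar>f x - f y\<bar>"
      if "\<eta> \<le> \<eta>0" "(x, f x) \<in> inflow_near_sing xl b \<eta>" "(y, f y) \<in> inflow_near_sing xl b \<eta>"
      for x y \<eta>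
      using that by (intro sep side)
  qed
qed

theorem lemma1:
  fixes \<Omega> :: "(real \<times> real) set" and b :: real and xl xu :: "real \<Rightarrow> real"
    and x2 :: "real \<times> real \<Rightarrow> real \<Rightarrow> real" and d :: "real \<times> real \<Rightarrow> real"
  assumes "two_singularity_domain \<Omega> b xl xu"
    and "\<And>p. p \<in> singular_points b \<Longrightarrow> analytic_graph_near (frontier \<Omega>) p (x2 p) (d p)"
  shows "\<exists>\<eta>0>0. \<forall>\<eta>. 0 < \<eta> \<and> \<eta> < \<eta>0 \<longrightarrow>
           (\<exists>(N::nat) C. C > 0 \<and>
              (\<forall>p \<in> singular_points b.
               \<forall>x1 \<in> {fst p - d p<..<fst p + d p}. \<forall>y1 \<in> {fst p - d p<..<fst p + d p}.
                 (x1, x2 p x1) \<in> inflow_near_sing xl b \<eta> \<longrightarrow>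
                 (y1, x2 p y1) \<in> inflow_near_sing xl b \<eta> \<longrightarrow>
                 \<bar>x2 p x1 - x2 p y1\<bar> \<ge> C * \<bar>x1 - y1\<bar> ^ N))"
proof -
  have b: "0 < b"
    and boundary: "frontier \<Omega> = side_curve xl b \<union> side_curve xu b \<union> singular_points b"
    and lim0: "(xl \<longlongrightarrow> 0) (at_right 0)" and limb: "(xl \<longlongrightarrow> 0) (at_left b)"
    and diff: "\<And>s. s \<in> {0<..<b} \<Longrightarrow> xl differentiable (at s)"
    and slope0: "filterlim (deriv xl) at_bot (at_right 0)"
    and slopeb: "filterlim (deriv xl) at_top (at_left b)"
    using assms(1) unfolding two_singularity_domain_def by simp_all
  have at0: "at 0 within {0<..<b} = at_right 0"
    by (rule at_within_nhd[where S = "{..<b}"]) (use b in auto)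
  have atb: "at b within {0<..<b} = at_left b"
    by (rule at_within_nhd[where S = "{0<..}"]) (use b in auto)
  have "\<exists>N C \<eta>0. C > 0 \<and> \<eta>0 > 0 \<and>
    (\<forall>x y \<eta>. x \<in> {- d (0, c)<..<d (0, c)} \<longrightarrow> y \<in> {- d (0, c)<..<d (0, c)} \<longrightarrow> \<eta> \<le> \<eta>0 \<longrightarrow>
       (x, x2 (0, c) x) \<in> inflow_near_sing xl b \<eta> \<longrightarrow> (y, x2 (0, c) y) \<in> inflow_near_sing xl b \<eta> \<longrightarrow>
       C * \<bar>x - y\<bar> ^ N \<le> \<bar>x2 (0, c) x - x2 (0, c) y\<bar>)" if c: "c \<in> {0, b}" for c
  proof -
    have sing: "(0, c) \<in> singular_points b" using c by (auto simp: singular_points_def)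
    then have in_frontier: "(0, c) \<in> frontier \<Omega>" using boundary by blast
    have F: "at c within {0<..<b} \<noteq> bot" "(xl \<longlongrightarrow> 0) (at c within {0<..<b})"
      using c lim0 limb by (auto simp: at0 atb)
    have "eventually (\<lambda>s. xl s \<le> 0) (at_right 0)"
      by (rule nonpos_right_of_singularity[OF lim0 slope0])
        (use b diff in \<open>auto simp: eventually_at_right_field\<close>)
    moreover have "eventually (\<lambda>s. xl s \<le> 0) (at_left b)"
      by (rule nonpos_left_of_singularity[OF limb slopeb])
        (use b diff in \<open>auto simp: eventually_at_left_field\<close>)
    ultimately have nonpos: "eventually (\<lambda>s. xl s \<le> 0) (at c within {0<..<b})"
      using c by (auto simp: at0 atb)
    have "{c, b - c} = {0, b}" using c by auto
    moreover note assms(2)[OF sing]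
    moreover have "side_curve xl b \<subseteq> frontier \<Omega>" using boundary by blast
    ultimately show ?thesis
      by (rule inflow_separation_at_singularity[OF b _ _ in_frontier _ F nonpos]) blast
  qed
  then obtain N C \<eta>0 where C: "\<And>c. c \<in> {0, b} \<Longrightarrow> C c > 0"
    and \<eta>0: "\<And>c. c \<in> {0, b} \<Longrightarrow> \<eta>0 c > 0"
    and sep: "\<And>c x y \<eta>. c \<in> {0, b} \<Longrightarrow> x \<in> {- d (0, c)<..<d (0, c)} \<Longrightarrow>
       y \<in> {- d (0, c)<..<d (0, c)} \<Longrightarrow> \<eta> \<le> \<eta>0 c \<Longrightarrow>
       (x, x2 (0, c) x) \<in> inflow_near_sing xl b \<eta> \<Longrightarrow>
       (y, x2 (0, c) y) \<in> inflow_near_sing xl b \<eta> \<Longrightarrow>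
       C c * \<bar>x - y\<bar> ^ N c \<le> \<bar>x2 (0, c) x - x2 (0, c) y\<bar>"
    by metis
  \<comment> \<open>The bound \<open>1 / 4\<close> gives \<open>\<bar>x - y\<bar> \<le> 4 * \<eta> \<le> 1\<close>.\<close>
  define \<eta>1 where "\<eta>1 = Min {\<eta>0 0, \<eta>0 b, 1 / 4}"
  define N1 where "N1 = max (N 0) (N b)"
  define C1 where "C1 = min (C 0) (C b)"
  have "\<bar>x2 p x - x2 p y\<bar> \<ge> C1 * \<bar>x - y\<bar> ^ N1"
    if \<eta>: "\<eta> < \<eta>1" and p: "p \<in> singular_points b"
      and xy: "x \<in> {fst p - d p<..<fst p + d p}" "y \<in> {fst p - d p<..<fst p + d p}"
      "(x, x2 p x) \<in> inflow_near_sing xl b \<eta>" "(y, x2 p y) \<in> inflow_near_sing xl b \<eta>"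
    for \<eta> p x y
  proof -
    obtain c where c: "c \<in> {0, b}" "p = (0, c)" using p by (auto simp: singular_points_def)
    have "\<bar>x\<bar> < 2 * \<eta>" "\<bar>y\<bar> < 2 * \<eta>" using xy(3,4) by (blast elim: inflow_near_sing_cases)+
    then have "\<bar>x - y\<bar> \<le> 1" using \<eta> by (auto simp: \<eta>1_def)
    then have "\<bar>x - y\<bar> ^ N1 \<le> \<bar>x - y\<bar> ^ N c"
      using c(1) by (intro power_decreasing) (auto simp: N1_def)
    then have "C1 * \<bar>x - y\<bar> ^ N1 \<le> C c * \<bar>x - y\<bar> ^ N c"
      using c(1) C[OF c(1)] by (intro mult_mono) (auto simp: C1_def)
    also have "\<dots> \<le> \<bar>x2 p x - x2 p y\<bar>"
      using sep[of c x y \<eta>] c xy \<eta> by (auto simp: \<eta>1_def)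
    finally show ?thesis .
  qed
  moreover have "C1 > 0" "\<eta>1 > 0" using C \<eta>0 by (auto simp: C1_def \<eta>1_def)
  ultimately show ?thesis by blast
qed

end
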